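(* Let $\alpha,\beta>0$, let $p$ be a probability measure on $\Omega$, and let $\mathcal F(q_\theta)=\frac12\mathrm{MMD}(p,q_\theta)^2$. Then $$\mathrm{grad}_{d_{\alpha,\beta}}\mathcal F(q_\theta)=L_\theta u\qquad\text{with}\qquad(\alpha D_\theta+\beta I)u=-\mu_{p-q_\theta}.$$ Consequently, the parametric regularized flow on the statistical manifold $$\frac{d\theta_t}{dt}=L_{\theta_t}(f_t),\qquad(\alpha D_{\theta_t}+\beta I)f_t=\mu_{p-q_{\theta_t}},$$ is the gradient flow of $\mathcal F$ with respect to $d_{\alpha,\beta}$, i.e. it coincides with $\partial_t\theta_t=-\mathrm{grad}_{d_{\alpha,\beta}}\mathcal F(q_{\theta_t})$.
   Context: Setting. $\Omega\subset\mathbb{R}^d$ is open and $\mathcal{H}$ is a reproducing kernel Hilbert space of real functions on $\Omega$ with bounded kernel $k$; $\langle\cdot,\cdot\rangle_{\mathcal H},\|\cdot\|_{\mathcal H}$ are its inner product and norm, and $\langle\cdot,\cdot\rangle,\|\cdot\|$ the Euclidean ones. The map $x\mapsto k(x,\cdot)\in\mathcal H$ is differentiable, $\nabla_x k(x,\cdot)\in\mathcal{H}^d$ is its gradient (in the first argument), so $\nabla f(x)=\langle f,\nabla_x k(x,\cdot)\rangle_{\mathcal H}$ for $f\in\mathcal H$. $\mathcal{Z}\subset\mathbb{R}^m$ is open with a probability distribution $\nu$; $\Theta\subset\mathbb{R}^n$ is a parameter space (all parameter points under consideration are understood to lie in $\Theta$); $G_\theta=(G_\theta^1,\dots,G_\theta^d):\mathcal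 Z\to\Omega$ is differentiable in $\theta$. It is assumed that $\|k(x,\cdot)-k(y,\cdot)\|_{\mathcal H}\le L\|x-y\|$ and $\|G_\theta(z)-G_{\theta'}(z)\|\le D(z)\|\theta-\theta'\|$ for a constant $L>0$ and a function $D:\mathcal Z\to[0,\infty)$ with $\mathbb{E}_\nu[D(z)^2]<\infty$. Put $q_\theta=(G_\theta)_\#\nu$ (push-forward) and $\mathcal P_\Theta=\{q_\theta:\theta\in\Theta\}$. For a probability distribution $\rho$ on $\Omega$, $\mu_\rho(x)=\int k(x,y)\rho(dy)\in\mathcal H$ is the kernel mean embedding, and $\mu_{\rho_1-\rho_2}=\mu_{\rho_1}-\mu_{\rho_2}$. $\mathrm{MMD}(p,q)=\|\mu_p-\mu_q\|_{\mathcal H}$. Operators. $J_\theta G_\theta(z)=\big(\partial G_\theta^j(z)/\partial\theta_i\big)_{ij}\in\mathbb{R}^{n\times d}$. $L_\theta:\mathcal H\to\mathbb{R}^n$, $L_\theta(f)=\int J_\theta G_\theta(z)\nabla f(G_\theta(z))\,\nu(dz)$; $L_\theta^\top:\mathbb{R}^n\to\mathcal H$, $L_\theta^\top(v)=\int\langle\nabla_x k(G_\theta(z),\cdot),J_\theta G_\theta(z)^\top v\rangle\,\nu(dz)$; $D_\theta=L_\theta^\top L_\theta:\mathcal H\to\mathcal H$ (symmetric, positive semidefinite); $I$ is the identity on $\mathcal H$, and $\alpha D_\theta+\beta I$ is invertible. Metric and gradient. $d_{\alpha,\beta}(q_{\theta_0},q_{\theta_1})^2=\min_{(\theta_t,f_t)}\int_0^1\big(\alpha\|D_{\theta_t}f_t\|_{\mathcal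 H}^2+\beta\langle f_t,D_{\theta_t}f_t\rangle_{\mathcal H}\big)dt$ over paths with $\partial_t\theta_t=L_{\theta_t}f_t$, $f_t\in\mathcal H$, $\theta_{t=0}=\theta_0,\theta_{t=1}=\theta_1$. The associated metric tensor is, for $\xi_i=L_\theta\varphi_i$ with $\varphi_i\in\mathcal H$ ($i=1,2$), $$g_\theta(\xi_1,\xi_2)=\alpha\langle D_\theta\varphi_1,D_\theta\varphi_2\rangle_{\mathcal H}+\beta\langle\varphi_1,D_\theta\varphi_2\rangle_{\mathcal H}.$$ For $\mathcal F:\mathcal P_\Theta\to\mathbb{R}$, the gradient $\mathrm{grad}_{d_{\alpha,\beta}}\mathcal F(q_\theta)$ is the vector in $\mathbb{R}^n$ (in the range of $L_\theta$, where $g_\theta$ is defined) satisfying $\frac{d}{dt}\mathcal F(q_{\theta_t})\big|_{t=0}=g_\theta(\mathrm{grad}_{d_{\alpha,\beta}}\mathcal F(q_\theta),\xi)$ for every differentiable curve $t\mapsto\theta_t\in\Theta$ with $\theta_{t=0}=\theta$ and $\partial_t\theta_t|_{t=0}=\xi=L_\theta\varphi$ for some $\varphi\in\mathcal H$.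
   Formalization: The parameter space Θ is assumed to be open, so that the partial derivatives of G_θ in θ are defined at each parameter point and the gradient, tested against differentiable curves in Θ, is unique. *)

theory Defs
  imports "HOL-Analysis.Analysis" "HOL-Probability.Probability_Measure"
begin

text \<open>
  A reproducing kernel Hilbert space of real functions on \<open>\<Omega>\<close> is a Hilbert space type \<open>'h\<close>
  together with \<open>ev\<close>, where \<open>ev f x\<close> is the value \<open>f(x)\<close>, and \<open>K\<close>, where \<open>K x\<close> is
  the element \<open>k(x,\<cdot>)\<close>; the kernel is \<open>k(x,y) = ev (K x) y\<close>. Only points of \<open>\<Omega>\<close> matter:
  two elements that agree on \<open>\<Omega>\<close> are equal.

  Vector-valued Bochner integrals require \<open>second_countable_topology\<close>, i.e. separability of
  the space. This is no restriction when \<open>x \<mapsto> k(x,\<cdot>)\<close> is continuous on \<open>\<Omega> \<subseteq> \<real>\<^sup>d\<close>,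
  since the linear span of its image is dense.
\<close>

definition rkhs ::
    "(real^'d) set \<Rightarrow> ('h::{real_inner, banach} \<Rightarrow> real^'d \<Rightarrow> real) \<Rightarrow> (real^'d \<Rightarrow> 'h) \<Rightarrow> bool" where
  "rkhs \<Omega> ev K \<longleftrightarrow>
     (\<forall>x\<in>\<Omega>. linear (\<lambda>f. ev f x)) \<and>
     (\<forall>f g. (\<forall>x\<in>\<Omega>. ev f x = ev g x) \<longrightarrow> f = g) \<and>
     (\<forall>f. \<forall>x\<in>\<Omega>. ev f x = f \<bullet> K x)"

definition mean_embedding ::
    "(real^'d) set \<Rightarrow> ('h \<Rightarrow> real^'d \<Rightarrow> real) \<Rightarrow> (real^'d \<Rightarrow> 'h) \<Rightarrow> (real^'d) measure \<Rightarrow> 'h" where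
  "mean_embedding \<Omega> ev K \<rho> = (THE h. \<forall>x\<in>\<Omega>. ev h x = (\<integral>y. ev (K x) y \<partial>\<rho>))"

definition MMD ::
    "(real^'d) set \<Rightarrow> ('h::real_inner \<Rightarrow> real^'d \<Rightarrow> real) \<Rightarrow> (real^'d \<Rightarrow> 'h) \<Rightarrow>
     (real^'d) measure \<Rightarrow> (real^'d) measure \<Rightarrow> real" where
  "MMD \<Omega> ev K p q = norm (mean_embedding \<Omega> ev K p - mean_embedding \<Omega> ev K q)"

definition pushforward_model ::
    "(real^'d) set \<Rightarrow> (real^'m) measure \<Rightarrow> (real^'n \<Rightarrow> real^'m \<Rightarrow> real^'d) \<Rightarrow> real^'n \<Rightarrow>
     (real^'d) measure" where
  "pushforward_model \<Omega> \<nu> G \<theta> = distr \<nu> (restrict_space borel \<Omega>) (G \<theta>)"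

text \<open>
  The vector of partial derivatives. It is used both for real functions \<open>ev f\<close> and for the
  feature map \<open>K\<close>, where its value lies in the \<open>d\<close>-fold product of the Hilbert space.
\<close>

definition nabla :: "(real^'d \<Rightarrow> 'b::real_normed_vector) \<Rightarrow> real^'d \<Rightarrow> 'b^'d" where
  "nabla f x = (\<chi> j. frechet_derivative f (at x) (axis j 1))"

text \<open>
  The library's \<open>jacobian\<close> has the entry \<open>\<partial>G\<^sup>j/\<partial>\<theta>\<^sub>i\<close> in row \<open>j\<close> and column
  \<open>i\<close>; here \<open>i\<close> indexes the rows.
\<close>

definition param_jacobian ::
    "(real^'n \<Rightarrow> real^'m \<Rightarrow> real^'d) \<Rightarrow> real^'n \<Rightarrow> real^'m \<Rightarrow> real^'d^'n" where
  "param_jacobian G \<theta> z = transpose (jacobian (\<lambda>\<eta>. G \<eta> z) (at \<theta>))"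

definition L_op ::
    "('h \<Rightarrow> real^'d \<Rightarrow> real) \<Rightarrow> (real^'m) measure \<Rightarrow> (real^'n \<Rightarrow> real^'m \<Rightarrow> real^'d) \<Rightarrow>
     real^'n \<Rightarrow> 'h \<Rightarrow> real^'n" where
  "L_op ev \<nu> G \<theta> f = (\<integral>z. param_jacobian G \<theta> z *v nabla (ev f) (G \<theta> z) \<partial>\<nu>)"

definition L_adj ::
    "(real^'d \<Rightarrow> 'h::{real_inner, banach, second_countable_topology}) \<Rightarrow> (real^'m) measure \<Rightarrow>
     (real^'n \<Rightarrow> real^'m \<Rightarrow> real^'d) \<Rightarrow> real^'n \<Rightarrow> real^'n \<Rightarrow> 'h" where
  "L_adj K \<nu> G \<theta> v =
     (\<integral>z. (\<Sum>j\<in>UNIV. (transpose (param_jacobian G \<theta> z) *v v) $ j *\<^sub>R nabla K (G \<theta> z) $ j) \<partial>\<nu>)"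

definition D_op ::
    "('h::{real_inner, banach, second_countable_topology} \<Rightarrow> real^'d \<Rightarrow> real) \<Rightarrow>
     (real^'d \<Rightarrow> 'h) \<Rightarrow> (real^'m) measure \<Rightarrow> (real^'n \<Rightarrow> real^'m \<Rightarrow> real^'d) \<Rightarrow>
     real^'n \<Rightarrow> 'h \<Rightarrow> 'h" where
  "D_op ev K \<nu> G \<theta> f = L_adj K \<nu> G \<theta> (L_op ev \<nu> G \<theta> f)"

text \<open>
  The metric tensor at \<open>\<theta>\<close>, meaningful for \<open>\<xi>\<^sub>1\<close>, \<open>\<xi>\<^sub>2\<close> in the range of \<open>L_op\<close>. The value does not
  depend on the chosen preimages, so the description is unique there.
\<close>

definition metric_tensor ::
    "real \<Rightarrow> real \<Rightarrow> ('h::{real_inner, banach, second_countable_topology} \<Rightarrow> real^'d \<Rightarrow> real) \<Rightarrow>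
     (real^'d \<Rightarrow> 'h) \<Rightarrow> (real^'m) measure \<Rightarrow> (real^'n \<Rightarrow> real^'m \<Rightarrow> real^'d) \<Rightarrow>
     real^'n \<Rightarrow> real^'n \<Rightarrow> real^'n \<Rightarrow> real" where
  "metric_tensor \<alpha> \<beta> ev K \<nu> G \<theta> \<xi>\<^sub>1 \<xi>\<^sub>2 =
     (THE r. \<exists>\<phi>\<^sub>1 \<phi>\<^sub>2. \<xi>\<^sub>1 = L_op ev \<nu> G \<theta> \<phi>\<^sub>1 \<and> \<xi>\<^sub>2 = L_op ev \<nu> G \<theta> \<phi>\<^sub>2 \<and>
        r = \<alpha> * (D_op ev K \<nu> G \<theta> \<phi>\<^sub>1 \<bullet> D_op ev K \<nu> G \<theta> \<phi>\<^sub>2) + \<beta> * (\<phi>\<^sub>1 \<bullet> D_op ev K \<nu> G \<theta> \<phi>\<^sub>2))"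

definition is_gradient ::
    "real \<Rightarrow> real \<Rightarrow> (real^'d) set \<Rightarrow>
     ('h::{real_inner, banach, second_countable_topology} \<Rightarrow> real^'d \<Rightarrow> real) \<Rightarrow>
     (real^'d \<Rightarrow> 'h) \<Rightarrow> (real^'m) measure \<Rightarrow> (real^'n) set \<Rightarrow> (real^'n \<Rightarrow> real^'m \<Rightarrow> real^'d) \<Rightarrow>
     ((real^'d) measure \<Rightarrow> real) \<Rightarrow> real^'n \<Rightarrow> real^'n \<Rightarrow> bool" where
  "is_gradient \<alpha> \<beta> \<Omega> ev K \<nu> \<Theta> G F \<theta> v \<longleftrightarrow>
     v \<in> range (L_op ev \<nu> G \<theta>) \<and>
     (\<forall>\<gamma> \<epsilon> \<xi>.
        \<epsilon> > 0 \<and> \<gamma> ` {-\<epsilon><..<\<epsilon>} \<subseteq> \<Theta> \<and> \<gamma> differentiable_on {-\<epsilon><..<\<epsilon>} \<and>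
        \<gamma> 0 = \<theta> \<and> (\<gamma> has_vector_derivative \<xi>) (at 0) \<and> \<xi> \<in> range (L_op ev \<nu> G \<theta>) \<longrightarrow>
        ((\<lambda>t. F (pushforward_model \<Omega> \<nu> G (\<gamma> t))) has_real_derivative
           metric_tensor \<alpha> \<beta> ev K \<nu> G \<theta> v \<xi>) (at 0))"

definition gradient ::
    "real \<Rightarrow> real \<Rightarrow> (real^'d) set \<Rightarrow>
     ('h::{real_inner, banach, second_countable_topology} \<Rightarrow> real^'d \<Rightarrow> real) \<Rightarrow>
     (real^'d \<Rightarrow> 'h) \<Rightarrow> (real^'m) measure \<Rightarrow> (real^'n) set \<Rightarrow> (real^'n \<Rightarrow> real^'m \<Rightarrow> real^'d) \<Rightarrow>
     ((real^'d) measure \<Rightarrow> real) \<Rightarrow> real^'n \<Rightarrow> real^'n" where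
  "gradient \<alpha> \<beta> \<Omega> ev K \<nu> \<Theta> G F \<theta> = (THE v. is_gradient \<alpha> \<beta> \<Omega> ev K \<nu> \<Theta> G F \<theta> v)"

definition is_gradient_flow ::
    "real \<Rightarrow> real \<Rightarrow> (real^'d) set \<Rightarrow>
     ('h::{real_inner, banach, second_countable_topology} \<Rightarrow> real^'d \<Rightarrow> real) \<Rightarrow>
     (real^'d \<Rightarrow> 'h) \<Rightarrow> (real^'m) measure \<Rightarrow> (real^'n) set \<Rightarrow> (real^'n \<Rightarrow> real^'m \<Rightarrow> real^'d) \<Rightarrow>
     ((real^'d) measure \<Rightarrow> real) \<Rightarrow> real set \<Rightarrow> (real \<Rightarrow> real^'n) \<Rightarrow> bool" where
  "is_gradient_flow \<alpha> \<beta> \<Omega> ev K \<nu> \<Theta> G F T \<theta> \<longleftrightarrow>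
     (\<forall>t\<in>T. \<theta> t \<in> \<Theta> \<and>
        (\<theta> has_vector_derivative - gradient \<alpha> \<beta> \<Omega> ev K \<nu> \<Theta> G F (\<theta> t)) (at t within T))"

definition is_regularized_flow ::
    "real \<Rightarrow> real \<Rightarrow> (real^'d) set \<Rightarrow>
     ('h::{real_inner, banach, second_countable_topology} \<Rightarrow> real^'d \<Rightarrow> real) \<Rightarrow>
     (real^'d \<Rightarrow> 'h) \<Rightarrow> (real^'m) measure \<Rightarrow> (real^'n) set \<Rightarrow> (real^'n \<Rightarrow> real^'m \<Rightarrow> real^'d) \<Rightarrow>
     (real^'d) measure \<Rightarrow> real set \<Rightarrow> (real \<Rightarrow> real^'n) \<Rightarrow> (real \<Rightarrow> 'h) \<Rightarrow> bool" where
  "is_regularized_flow \<alpha> \<beta> \<Omega> ev K \<nu> \<Theta> G p T \<theta> f \<longleftrightarrow>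
     (\<forall>t\<in>T. \<theta> t \<in> \<Theta> \<and>
        (\<theta> has_vector_derivative L_op ev \<nu> G (\<theta> t) (f t)) (at t within T) \<and>
        \<alpha> *\<^sub>R D_op ev K \<nu> G (\<theta> t) (f t) + \<beta> *\<^sub>R f t =
          mean_embedding \<Omega> ev K p - mean_embedding \<Omega> ev K (pushforward_model \<Omega> \<nu> G (\<theta> t)))"

end

theory Submission
  imports Defs
begin

text \<open>
  The mean embedding of \<open>q\<^sub>\<theta>\<close> is \<open>\<integral>z. K (G \<theta> z) \<partial>\<nu>\<close>. The two Lipschitz conditions give
  an integrable bound on its difference quotients, so by dominated convergence it is Frechet
  differentiable in \<open>\<theta>\<close> with derivative \<open>L\<^sub>\<theta>\<^sup>T\<close>, the adjoint of \<open>L\<^sub>\<theta>\<close>. Hence the energy has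
  derivative \<open>\<xi> \<mapsto> -\<mu> \<bullet> L\<^sub>\<theta>\<^sup>T \<xi>\<close> with \<open>\<mu> = \<mu>\<^sub>p - \<mu>\<^sub>q\<close>. Substituting
  \<open>-\<mu> = \<alpha> D\<^sub>\<theta> u + \<beta> u\<close> turns this into
  \<open>\<alpha> (L\<^sub>\<theta>\<^sup>T L\<^sub>\<theta> u \<bullet> L\<^sub>\<theta>\<^sup>T \<xi>) + \<beta> (L\<^sub>\<theta> u \<bullet> \<xi>)\<close>, which is the metric tensor at
  \<open>(L\<^sub>\<theta> u, \<xi>)\<close>. This form is positive definite, so the gradient is unique.
\<close>

section \<open>Derivatives as limits of difference quotients\<close>

text \<open>Limits along sequences preserve measurability and norm bounds; the derivative of the
  feature map obtains both properties in this way.\<close>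

lemma has_derivative_directional_sequentially:
  fixes f :: "'a::real_normed_vector \<Rightarrow> 'b::real_normed_vector"
  assumes der: "(f has_derivative f') (at x)"
    and s: "s \<longlonglongrightarrow> 0" "\<And>n. s n \<noteq> (0::real)"
  shows "(\<lambda>n. inverse (s n) *\<^sub>R (f (x + s n *\<^sub>R v) - f x)) \<longlonglongrightarrow> f' v"
proof -
  define g where "g t = f (x + t *\<^sub>R v)" for t
  have "((\<lambda>t. x + t *\<^sub>R v) has_derivative (\<lambda>t. t *\<^sub>R v)) (at 0)"
    using has_derivative_add[OF has_derivative_const has_derivative_scaleR_left[OF has_derivative_ident]]
    by simp
  then have "(g has_derivative (\<lambda>t. f' (t *\<^sub>R v))) (at 0)"
    unfolding g_def by (rule has_derivative_compose[where g = f]) (simp add: der)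
  then have "((\<lambda>h. norm (g (0 + h) - g 0 - f' (h *\<^sub>R v)) / norm h) \<longlongrightarrow> 0) (at 0)"
    unfolding has_derivative_at by simp
  then have "(\<lambda>n. norm (g (0 + s n) - g 0 - f' (s n *\<^sub>R v)) / norm (s n)) \<longlonglongrightarrow> 0"
    using s unfolding tendsto_at_iff_sequentially by (auto simp: o_def)
  moreover have "norm (g (0 + s n) - g 0 - f' (s n *\<^sub>R v)) / norm (s n)
      = norm (inverse (s n) *\<^sub>R (f (x + s n *\<^sub>R v) - f x) - f' v)" for n
  proof -
    have "f' (s n *\<^sub>R v) = s n *\<^sub>R f' v"
      using has_derivative_linear[OF der] by (rule linear_scale)
    then have "inverse (s n) *\<^sub>R (f (x + s n *\<^sub>R v) - f x) - f' v
        = inverse (s n) *\<^sub>R (g (0 + s n) - g 0 - f' (s n *\<^sub>R v))"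
      using s(2)[of n] by (simp add: g_def scaleR_diff_right)
    then show ?thesis
      by (simp add: divide_inverse mult.commute)
  qed
  ultimately show ?thesis
    by (simp add: LIM_zero_iff tendsto_norm_zero_iff)
qed

lemma open_direction_sequence:
  fixes x v :: "'a::real_normed_vector"
  assumes "open S" "x \<in> S"
  obtains s :: "nat \<Rightarrow> real"
  where "s \<longlonglongrightarrow> 0" "\<And>n. s n > 0" "\<And>n. x + s n *\<^sub>R v \<in> S"
proof -
  obtain \<delta> where \<delta>: "\<delta> > 0" "ball x \<delta> \<subseteq> S"
    using assms open_contains_ball by blast
  \<comment> \<open>The summand \<open>1\<close> keeps the denominator positive when
    \<open>v = 0\<close> and makes every displacement strictly shorter than
    \<open>\<delta>\<close>.\<close>
  define s where "s n = \<delta> / (1 + norm v) * inverse (real (Suc n))" for n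
  have v: "1 + norm v > 0"
    by (simp add: add_pos_nonneg)
  have "s \<longlonglongrightarrow> \<delta> / (1 + norm v) * 0"
    unfolding s_def by (intro tendsto_mult tendsto_const LIMSEQ_inverse_real_of_nat)
  moreover have pos: "s n > 0" for n
    using v \<delta> by (simp add: s_def)
  moreover have "x + s n *\<^sub>R v \<in> S" for n
  proof -
    have "s n \<le> \<delta> / (1 + norm v) * 1"
      unfolding s_def using v \<delta> by (intro mult_left_mono) (auto simp: divide_simps)
    then have "s n * norm v \<le> \<delta> / (1 + norm v) * norm v"
      by (intro mult_right_mono) auto
    also have "\<dots> < \<delta>"
      using v \<delta> by (simp add: field_simps)
    finally show ?thesis
      using \<delta> pos[of n] by (intro subsetD[OF \<delta>(2)]) (auto simp: dist_norm)
  qed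
  ultimately show ?thesis
    by (intro that[of s]) auto
qed

text \<open>Each difference quotient in direction \<open>v\<close> has norm at most
  \<open>C * norm v\<close>, and the bound passes to the limit. Openness of \<open>S\<close> keeps
  the sampled points where the Lipschitz estimate holds.\<close>

lemma has_derivative_norm_le_lipschitz:
  fixes f :: "'a::real_normed_vector \<Rightarrow> 'b::real_normed_vector"
  assumes der: "(f has_derivative f') (at x)" and S: "open S" "x \<in> S"
    and lip: "\<And>y. y \<in> S \<Longrightarrow> norm (f y - f x) \<le> C * norm (y - x)"
  shows "norm (f' v) \<le> C * norm v"
proof -
  obtain s where s: "s \<longlonglongrightarrow> 0" "\<And>n. s n > (0::real)" "\<And>n. x + s n *\<^sub>R v \<in> S"
    using open_direction_sequence[OF S] by metis
  have "(\<lambda>n. inverse (s n) *\<^sub>R (f (x + s n *\<^sub>R v) - f x)) \<longlonglongrightarrow> f' v"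
    using s by (intro has_derivative_directional_sequentially[OF der]) (auto simp: less_imp_neq[symmetric])
  moreover have "norm (inverse (s n) *\<^sub>R (f (x + s n *\<^sub>R v) - f x)) \<le> C * norm v" for n
  proof -
    have "norm (f (x + s n *\<^sub>R v) - f x) \<le> C * (s n * norm v)"
      using lip[OF s(3)[of n]] s(2)[of n] by simp
    then show ?thesis
      using s(2)[of n] by (simp add: divide_inverse_commute[symmetric] pos_divide_le_eq mult_ac)
  qed
  ultimately show ?thesis
    by (intro Lim_norm_ubound[where net = sequentially]) auto
qed

section \<open>Definiteness of weighted sums, and coordinate forms of derivatives\<close>

text \<open>Serves as the definiteness argument three times: for the finite-dimensional system, for
  uniqueness of \<open>u\<close>, and for uniqueness of the gradient.\<close>

lemma weighted_inner_self_sum_eq_0: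
  fixes x :: "'a::real_inner" and y :: "'b::real_inner"
  assumes "a > 0" "b > 0" "a * (x \<bullet> x) + b * (y \<bullet> y) = 0"
  shows "y = 0"
proof -
  have "a * (x \<bullet> x) \<ge> 0" "b * (y \<bullet> y) \<ge> 0"
    using assms by simp_all
  with assms(3) have "b * (y \<bullet> y) = 0"
    by linarith
  with \<open>b > 0\<close> show ?thesis
    by simp
qed

text \<open>Turns the sum of partial derivatives in \<open>L_adj\<close> into a Frechet derivative,
  to which the chain rule applies.\<close>

lemma sum_scaleR_nabla:
  fixes f :: "real^'d \<Rightarrow> 'b::real_normed_vector"
  assumes "f differentiable at x"
  shows "(\<Sum>j\<in>UNIV. w $ j *\<^sub>R nabla f x $ j) = frechet_derivative f (at x) w"
proof -
  interpret linear "frechet_derivative f (at x)"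
    using assms by (rule linear_frechet_derivative)
  have "frechet_derivative f (at x) w = frechet_derivative f (at x) (\<Sum>j\<in>UNIV. w $ j *\<^sub>R axis j 1)"
    using basis_expansion[of w] by (simp add: scalar_mult_eq_scaleR)
  then show ?thesis
    by (simp add: sum scale nabla_def)
qed

lemma transpose_param_jacobian_mult:
  assumes "(\<lambda>\<eta>. G \<eta> z) differentiable at \<theta>"
  shows "transpose (param_jacobian G \<theta> z) *v v = frechet_derivative (\<lambda>\<eta>. G \<eta> z) (at \<theta>) v"
  using matrix_works[of "frechet_derivative (\<lambda>\<eta>. G \<eta> z) (at \<theta>)" v] linear_frechet_derivative[OF assms]
  by (simp add: param_jacobian_def jacobian_def linear_def scalar_mult_eq_scaleR[abs_def])

section \<open>The kernel model and its mean embeddings\<close>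

locale kernel_model =
  fixes \<Omega> :: "(real^'d) set" and Z :: "(real^'m) set" and \<Theta> :: "(real^'n) set"
    and ev :: "'h::{real_inner, banach, second_countable_topology} \<Rightarrow> real^'d \<Rightarrow> real"
    and K :: "real^'d \<Rightarrow> 'h"
    and \<nu> :: "(real^'m) measure"
    and G :: "real^'n \<Rightarrow> real^'m \<Rightarrow> real^'d"
    and D :: "real^'m \<Rightarrow> real"
    and L B :: real
  assumes open_\<Omega>: "open \<Omega>" and open_\<Theta>: "open \<Theta>"
    and rkhs: "rkhs \<Omega> ev K"
    and kernel_bounded: "\<And>x. x \<in> \<Omega> \<Longrightarrow> \<bar>ev (K x) x\<bar> \<le> B"
    and kernel_differentiable: "\<And>x. x \<in> \<Omega> \<Longrightarrow> K differentiable (at x)"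
    and L_pos: "L > 0"
    and kernel_lipschitz:
      "\<And>x y. x \<in> \<Omega> \<Longrightarrow> y \<in> \<Omega> \<Longrightarrow> norm (K x - K y) \<le> L * norm (x - y)"
    and prob_\<nu>: "prob_space \<nu>" and sets_\<nu>: "sets \<nu> = sets (restrict_space borel Z)"
    and G_measurable: "\<And>\<theta>. \<theta> \<in> \<Theta> \<Longrightarrow> G \<theta> \<in> measurable \<nu> (restrict_space borel \<Omega>)"
    and G_differentiable:
      "\<And>\<theta> z. \<theta> \<in> \<Theta> \<Longrightarrow> z \<in> Z \<Longrightarrow> (\<lambda>\<eta>. G \<eta> z) differentiable (at \<theta>)"
    and D_nonneg: "\<And>z. z \<in> Z \<Longrightarrow> D z \<ge> 0"
    and D_square_integrable: "integrable \<nu> (\<lambda>z. (D z)\<^sup>2)"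
    and G_lipschitz: "\<And>\<theta> \<theta>' z. \<theta> \<in> \<Theta> \<Longrightarrow> \<theta>' \<in> \<Theta> \<Longrightarrow> z \<in> Z \<Longrightarrow>
      norm (G \<theta> z - G \<theta>' z) \<le> D z * norm (\<theta> - \<theta>')"
begin

lemma ev_eq: "x \<in> \<Omega> \<Longrightarrow> ev f x = f \<bullet> K x"
  using rkhs unfolding rkhs_def by blast

lemma eq_if_ev_eq: "(\<And>x. x \<in> \<Omega> \<Longrightarrow> ev f x = ev g x) \<Longrightarrow> f = g"
  using rkhs unfolding rkhs_def by blast

lemma space_\<nu>: "space \<nu> = Z"
  using sets_eq_imp_space_eq[OF sets_\<nu>] by (simp add: space_restrict_space)

lemma G_in_\<Omega>: "\<theta> \<in> \<Theta> \<Longrightarrow> z \<in> Z \<Longrightarrow> G \<theta> z \<in> \<Omega>"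
  using measurable_space[OF G_measurable, of \<theta> z] by (simp add: space_\<nu> space_restrict_space)

text \<open>By the reproducing property \<open>ev (K x) x\<close> is the squared norm of
  \<open>K x\<close>, so a bound on the diagonal of the kernel bounds the feature map.\<close>

lemma norm_K_le: "x \<in> \<Omega> \<Longrightarrow> norm (K x) \<le> sqrt B"
  using kernel_bounded[of x] by (simp add: ev_eq norm_eq_sqrt_inner)

lemma K_measurable: "K \<in> borel_measurable (restrict_space borel \<Omega>)"
proof (rule borel_measurable_continuous_on_restrict)
  show "continuous_on \<Omega> K"
    using kernel_differentiable
    by (auto intro!: continuous_at_imp_continuous_on differentiable_imp_continuous_within)
qed

lemma K_G_measurable: "\<theta> \<in> \<Theta> \<Longrightarrow> (\<lambda>z. K (G \<theta> z)) \<in> borel_measurable \<nu>"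
  using measurable_compose[OF G_measurable K_measurable] .

lemma K_G_integrable:
  assumes "\<theta> \<in> \<Theta>"
  shows "integrable \<nu> (\<lambda>z. K (G \<theta> z))"
proof -
  interpret prob_space \<nu> by (rule prob_\<nu>)
  show ?thesis
    using assms norm_K_le G_in_\<Omega>
    by (intro integrable_const_bound[where B = "sqrt B"] K_G_measurable) (auto simp: space_\<nu>)
qed

lemma D_integrable: "integrable \<nu> D"
proof -
  interpret prob_space \<nu> by (rule prob_\<nu>)
  \<comment> \<open>Measurability of \<open>D\<close> is recovered from that of its square: on
    \<open>Z\<close>, the space of \<open>\<nu>\<close>, nonnegativity makes \<open>D\<close> the
    root of its square.\<close>
  have "(\<lambda>z. sqrt ((D z)\<^sup>2)) \<in> borel_measurable \<nu>"
    using D_square_integrable by measurable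
  then have "D \<in> borel_measurable \<nu>"
    using D_nonneg by (subst measurable_cong[where g = "\<lambda>z. sqrt ((D z)\<^sup>2)"]) (auto simp: space_\<nu>)
  then show ?thesis
    using square_integrable_imp_integrable D_square_integrable by blast
qed

text \<open>The inner product with \<open>K x\<close> commutes with the Bochner integral, so the
  integral of \<open>K\<close> has the prescribed values on \<open>\<Omega>\<close>; these values
  determine an element.\<close>

lemma mean_embedding_eq:
  assumes "prob_space \<rho>" "sets \<rho> = sets (restrict_space borel \<Omega>)"
  shows "mean_embedding \<Omega> ev K \<rho> = (\<integral>y. K y \<partial>\<rho>)"
proof -
  interpret prob_space \<rho> by fact
  have sp: "space \<rho> = \<Omega>"
    using sets_eq_imp_space_eq[OF assms(2)] by (simp add: space_restrict_space)
  have "K \<in> borel_measurable \<rho>"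
    using K_measurable measurable_cong_sets[OF assms(2) refl] by blast
  then have int: "integrable \<rho> K"
    using norm_K_le by (intro integrable_const_bound[where B = "sqrt B"]) (auto simp: sp)
  have *: "ev (\<integral>y. K y \<partial>\<rho>) x = (\<integral>y. ev (K x) y \<partial>\<rho>)" if "x \<in> \<Omega>" for x
  proof -
    have "(\<integral>y. ev (K x) y \<partial>\<rho>) = (\<integral>y. K x \<bullet> K y \<partial>\<rho>)"
      by (intro Bochner_Integration.integral_cong) (auto simp: ev_eq sp)
    also have "\<dots> = K x \<bullet> (\<integral>y. K y \<partial>\<rho>)"
      using int by simp
    finally show ?thesis
      using that by (simp add: ev_eq inner_commute)
  qed
  then show ?thesis
    unfolding mean_embedding_def by (intro the_equality ballI eq_if_ev_eq) simp_all
qed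

text \<open>The change of variables moves \<open>\<theta>\<close> from the measure into the
  integrand, where it can be differentiated.\<close>

lemma mean_embedding_pushforward:
  assumes "\<theta> \<in> \<Theta>"
  shows "mean_embedding \<Omega> ev K (pushforward_model \<Omega> \<nu> G \<theta>) = (\<integral>z. K (G \<theta> z) \<partial>\<nu>)"
proof -
  have "prob_space (pushforward_model \<Omega> \<nu> G \<theta>)"
    unfolding pushforward_model_def
    using prob_space.prob_space_distr[OF prob_\<nu> G_measurable[OF assms]] .
  then have "mean_embedding \<Omega> ev K (pushforward_model \<Omega> \<nu> G \<theta>)
      = (\<integral>y. K y \<partial>pushforward_model \<Omega> \<nu> G \<theta>)"
    by (rule mean_embedding_eq) (simp add: pushforward_model_def)
  also have "\<dots> = (\<integral>z. K (G \<theta> z) \<partial>\<nu>)"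
    unfolding pushforward_model_def
    by (rule integral_distr[OF G_measurable[OF assms] K_measurable])
  finally show ?thesis .
qed

text \<open>Differentiates the reproducing identity. That identity holds on \<open>\<Omega>\<close>
  only, which suffices at \<open>x\<close> because \<open>\<Omega>\<close> is open.\<close>

lemma nabla_ev:
  assumes "x \<in> \<Omega>"
  shows "nabla (ev f) x $ j = f \<bullet> nabla K x $ j"
proof -
  have "((\<lambda>y. f \<bullet> K y) has_derivative (\<lambda>h. f \<bullet> frechet_derivative K (at x) h)) (at x)"
    using kernel_differentiable[OF assms]
    by (intro has_derivative_inner_right) (simp add: frechet_derivative_works)
  then have "(ev f has_derivative (\<lambda>h. f \<bullet> frechet_derivative K (at x) h)) (at x)"
    by (rule has_derivative_transform_within_open[OF _ open_\<Omega> assms]) (simp add: ev_eq)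
  then have "frechet_derivative (ev f) (at x) = (\<lambda>h. f \<bullet> frechet_derivative K (at x) h)"
    by (rule frechet_derivative_at[symmetric])
  then show ?thesis
    by (simp add: nabla_def)
qed

section \<open>Differentiating the mean embedding in the parameter\<close>

text \<open>The integrand of \<open>L_adj\<close>. By the chain rule it is the derivative of
  \<open>K (G \<eta> z)\<close> in \<open>\<eta>\<close> at \<open>\<theta>\<close>.\<close>

definition feature_deriv :: "real^'n \<Rightarrow> real^'m \<Rightarrow> real^'n \<Rightarrow> 'h" where
  "feature_deriv \<theta> z v =
     (\<Sum>j\<in>UNIV. (transpose (param_jacobian G \<theta> z) *v v) $ j *\<^sub>R nabla K (G \<theta> z) $ j)"

lemma L_adj_eq: "L_adj K \<nu> G \<theta> v = (\<integral>z. feature_deriv \<theta> z v \<partial>\<nu>)"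
  by (simp add: L_adj_def feature_deriv_def)

lemma has_derivative_K_G:
  assumes "\<theta> \<in> \<Theta>" "z \<in> Z"
  shows "((\<lambda>\<eta>. K (G \<eta> z)) has_derivative feature_deriv \<theta> z) (at \<theta>)"
proof -
  have "feature_deriv \<theta> z
      = (\<lambda>v. frechet_derivative K (at (G \<theta> z)) (frechet_derivative (\<lambda>\<eta>. G \<eta> z) (at \<theta>) v))"
    using assms kernel_differentiable G_in_\<Omega> G_differentiable
    by (simp add: fun_eq_iff feature_deriv_def sum_scaleR_nabla transpose_param_jacobian_mult
        del: transpose_matrix_vector)
  moreover have "((\<lambda>\<eta>. G \<eta> z) has_derivative frechet_derivative (\<lambda>\<eta>. G \<eta> z) (at \<theta>)) (at \<theta>)"
    "(K has_derivative frechet_derivative K (at (G \<theta> z))) (at (G \<theta> z))"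
    using assms kernel_differentiable G_in_\<Omega> G_differentiable
    by (auto simp flip: frechet_derivative_works)
  ultimately show ?thesis
    using has_derivative_compose[where g = K and f = "\<lambda>\<eta>. G \<eta> z"] by metis
qed

lemma K_G_lipschitz:
  assumes "\<theta> \<in> \<Theta>" "\<eta> \<in> \<Theta>" "z \<in> Z"
  shows "norm (K (G \<eta> z) - K (G \<theta> z)) \<le> L * D z * norm (\<eta> - \<theta>)"
proof -
  have "norm (K (G \<eta> z) - K (G \<theta> z)) \<le> L * norm (G \<eta> z - G \<theta> z)"
    using assms by (intro kernel_lipschitz G_in_\<Omega>)
  also have "\<dots> \<le> L * (D z * norm (\<eta> - \<theta>))"
    using assms L_pos by (intro mult_left_mono G_lipschitz) auto
  finally show ?thesis
    by (simp add: mult.assoc)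
qed

lemma norm_feature_deriv_le:
  assumes "\<theta> \<in> \<Theta>" "z \<in> Z"
  shows "norm (feature_deriv \<theta> z v) \<le> L * D z * norm v"
  using has_derivative_norm_le_lipschitz[OF has_derivative_K_G[OF assms] open_\<Theta> assms(1)]
    K_G_lipschitz assms by blast

text \<open>Measurability in \<open>z\<close> is not visible from the formula, which contains
  derivatives of \<open>G\<close>. It follows because the derivative is a pointwise limit of
  difference quotients taken at parameters in \<open>\<Theta>\<close>, each measurable.\<close>

lemma feature_deriv_measurable:
  assumes "\<theta> \<in> \<Theta>"
  shows "(\<lambda>z. feature_deriv \<theta> z v) \<in> borel_measurable \<nu>"
proof -
  obtain s where s: "s \<longlonglongrightarrow> 0" "\<And>n. s n > (0::real)" "\<And>n. \<theta> + s n *\<^sub>R v \<in> \<Theta>"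
    using open_direction_sequence[OF open_\<Theta> assms] by metis
  show ?thesis
  proof (rule borel_measurable_LIMSEQ_metric)
    show "(\<lambda>z. inverse (s n) *\<^sub>R (K (G (\<theta> + s n *\<^sub>R v) z) - K (G \<theta> z))) \<in> borel_measurable \<nu>" for n
      using K_G_measurable[OF s(3)[of n]] K_G_measurable[OF assms] by measurable
    show "(\<lambda>n. inverse (s n) *\<^sub>R (K (G (\<theta> + s n *\<^sub>R v) z) - K (G \<theta> z))) \<longlonglongrightarrow> feature_deriv \<theta> z v"
      if "z \<in> space \<nu>" for z
      using that assms s
      by (intro has_derivative_directional_sequentially[where f = "\<lambda>\<eta>. K (G \<eta> z)"] has_derivative_K_G)
        (auto simp: space_\<nu> less_imp_neq[symmetric])
  qed
qed

lemma feature_deriv_integrable: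
  assumes "\<theta> \<in> \<Theta>"
  shows "integrable \<nu> (\<lambda>z. feature_deriv \<theta> z v)"
proof (rule Bochner_Integration.integrable_bound)
  show "integrable \<nu> (\<lambda>z. L * D z * norm v)"
    using D_integrable by simp
  show "AE z in \<nu>. norm (feature_deriv \<theta> z v) \<le> norm (L * D z * norm v)"
    using norm_feature_deriv_le[OF assms] order_trans[OF _ abs_ge_self] by (intro AE_I2) (fastforce simp: space_\<nu>)
qed (rule feature_deriv_measurable[OF assms])

text \<open>Boundedness is automatic, since the domain is finite-dimensional.\<close>

lemma bounded_linear_L_adj:
  assumes "\<theta> \<in> \<Theta>"
  shows "bounded_linear (L_adj K \<nu> G \<theta>)"
proof -
  have "linear (L_adj K \<nu> G \<theta>)"
  proof (rule linearI)
    have lin: "linear (feature_deriv \<theta> z)" for z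
      by (rule linearI) (simp_all add: feature_deriv_def matrix_vector_right_distrib scaleR_add_left
          sum.distrib scaleR_sum_right matrix_vector_mult_scaleR)
    show "L_adj K \<nu> G \<theta> (v + w) = L_adj K \<nu> G \<theta> v + L_adj K \<nu> G \<theta> w" for v w
      by (simp add: L_adj_eq linear_add[OF lin] feature_deriv_integrable[OF assms])
    show "L_adj K \<nu> G \<theta> (c *\<^sub>R v) = c *\<^sub>R L_adj K \<nu> G \<theta> v" for c v
      by (simp add: L_adj_eq linear_scale[OF lin])
  qed
  then show ?thesis
    by (rule linear_conv_bounded_linear[THEN iffD1])
qed

lemma has_derivative_mean_embedding_model:
  assumes \<theta>: "\<theta> \<in> \<Theta>"
  shows "((\<lambda>\<eta>. \<integral>z. K (G \<eta> z) \<partial>\<nu>) has_derivative L_adj K \<nu> G \<theta>) (at \<theta>)"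
proof -
  let ?M = "\<lambda>\<eta>. \<integral>z. K (G \<eta> z) \<partial>\<nu>"
  let ?r = "\<lambda>h z. norm (K (G (\<theta> + h) z) - K (G \<theta> z) - feature_deriv \<theta> z h) / norm h"
  obtain \<delta> where \<delta>: "\<delta> > 0" "ball \<theta> \<delta> \<subseteq> \<Theta>"
    using open_\<Theta> \<theta> open_contains_ball by blast
  have in\<Theta>: "\<theta> + h \<in> \<Theta>" if "h \<in> ball 0 \<delta>" for h
    using that \<delta>(2) by (intro subsetD[OF \<delta>(2)]) (simp add: dist_norm)
  \<comment> \<open>Restricting \<open>h\<close> to the ball keeps \<open>\<theta> + h\<close> in
    \<open>\<Theta>\<close>, so every term of a test sequence is covered by the estimates; sequences
    are what dominated convergence handles.\<close>
  have "((\<lambda>h. norm (?M (\<theta> + h) - ?M \<theta> - L_adj K \<nu> G \<theta> h) / norm h) \<longlongrightarrow> 0) (at 0 within ball 0 \<delta>)"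
    unfolding tendsto_at_iff_sequentially comp_def
  proof (intro allI impI)
    fix X :: "nat \<Rightarrow> real^'n" assume X: "\<forall>i. X i \<in> ball 0 \<delta> - {0}" and X0: "X \<longlonglongrightarrow> 0"
    have int: "integrable \<nu> (\<lambda>z. K (G (\<theta> + X i) z) - K (G \<theta> z) - feature_deriv \<theta> z (X i))" for i
      using X by (intro Bochner_Integration.integrable_diff K_G_integrable feature_deriv_integrable \<theta> in\<Theta>) auto
    have "(\<lambda>i. \<integral>z. ?r (X i) z \<partial>\<nu>) \<longlonglongrightarrow> (\<integral>z. 0 \<partial>\<nu>)"
    proof (rule integral_dominated_convergence)
      show "?r (X i) \<in> borel_measurable \<nu>" for i
        using borel_measurable_integrable[OF int[of i]] by measurable
      \<comment> \<open>One \<open>L * D z\<close> bounds the difference quotient of the feature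
        map, the other bounds its derivative.\<close>
      show "integrable \<nu> (\<lambda>z. 2 * (L * D z))"
        using D_integrable by simp
      show "AE z in \<nu>. (\<lambda>i. ?r (X i) z) \<longlonglongrightarrow> 0"
      proof (rule AE_I2)
        fix z assume "z \<in> space \<nu>"
        then have "((\<lambda>h. ?r h z) \<longlongrightarrow> 0) (at 0)"
          using has_derivative_K_G[OF \<theta>] by (simp add: space_\<nu> has_derivative_at)
        then show "(\<lambda>i. ?r (X i) z) \<longlonglongrightarrow> 0"
          using X X0 unfolding tendsto_at_iff_sequentially by (auto simp: o_def)
      qed
      show "AE z in \<nu>. norm (?r (X i) z) \<le> 2 * (L * D z)" for i
      proof (rule AE_I2)
        fix z assume "z \<in> space \<nu>"
        then have z: "z \<in> Z" by (simp add: space_\<nu>)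
        have Xi: "X i \<in> ball 0 \<delta>" "X i \<noteq> 0" using X by auto
        have "norm (K (G (\<theta> + X i) z) - K (G \<theta> z) - feature_deriv \<theta> z (X i))
            \<le> L * D z * norm (X i) + L * D z * norm (X i)"
          using K_G_lipschitz[OF \<theta> in\<Theta>[OF Xi(1)] z] norm_feature_deriv_le[OF \<theta> z, of "X i"]
          by (intro norm_triangle_le_diff) simp
        then show "norm (?r (X i) z) \<le> 2 * (L * D z)"
          using Xi(2) by (simp add: divide_le_eq)
      qed
    qed simp
    then have lim: "(\<lambda>i. \<integral>z. ?r (X i) z \<partial>\<nu>) \<longlonglongrightarrow> 0"
      by simp
    \<comment> \<open>The remainder of the integral is the integral of the pointwise remainders, so
      its norm is squeezed by the limit just found.\<close>
    have le: "norm (?M (\<theta> + X i) - ?M \<theta> - L_adj K \<nu> G \<theta> (X i)) / norm (X i) \<le> (\<integral>z. ?r (X i) z \<partial>\<nu>)" for i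
    proof -
      have "?M (\<theta> + X i) - ?M \<theta> - L_adj K \<nu> G \<theta> (X i)
          = (\<integral>z. K (G (\<theta> + X i) z) - K (G \<theta> z) - feature_deriv \<theta> z (X i) \<partial>\<nu>)"
        using X by (simp add: L_adj_eq K_G_integrable feature_deriv_integrable \<theta> in\<Theta>)
      then have "norm (?M (\<theta> + X i) - ?M \<theta> - L_adj K \<nu> G \<theta> (X i))
          \<le> (\<integral>z. norm (K (G (\<theta> + X i) z) - K (G \<theta> z) - feature_deriv \<theta> z (X i)) \<partial>\<nu>)"
        by (simp add: integral_norm_bound)
      then show ?thesis
        by (simp add: divide_right_mono)
    qed
    show "(\<lambda>i. norm (?M (\<theta> + X i) - ?M \<theta> - L_adj K \<nu> G \<theta> (X i)) / norm (X i)) \<longlonglongrightarrow> 0"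
      by (rule tendsto_sandwich[OF _ _ tendsto_const lim]) (use le in auto)
  qed
  \<comment> \<open>The ball is an open neighbourhood of \<open>0\<close>, so the restricted limit
    is the full one.\<close>
  then have "((\<lambda>h. norm (?M (\<theta> + h) - ?M \<theta> - L_adj K \<nu> G \<theta> h) / norm h) \<longlongrightarrow> 0) (at 0)"
    using \<delta>(1) by (subst (asm) at_within_open) auto
  then show ?thesis
    unfolding has_derivative_at using bounded_linear_L_adj[OF \<theta>] by blast
qed

section \<open>Adjointness, the metric tensor and the regularized equation\<close>

text \<open>For each \<open>z\<close> the Jacobian moves across the inner product as its transpose
  and \<open>nabla_ev\<close> moves the gradient onto \<open>K\<close>; integration over
  \<open>z\<close> then gives the claim.\<close>

lemma L_op_adjoint:
  assumes \<theta>: "\<theta> \<in> \<Theta>"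
  shows "v \<bullet> L_op ev \<nu> G \<theta> f = L_adj K \<nu> G \<theta> v \<bullet> f"
proof -
  let ?F = "\<lambda>z. param_jacobian G \<theta> z *v nabla (ev f) (G \<theta> z)"
  have inner_F: "w \<bullet> ?F z = feature_deriv \<theta> z w \<bullet> f" if "z \<in> space \<nu>" for w z
  proof -
    have "w \<bullet> ?F z = (transpose (param_jacobian G \<theta> z) *v w) \<bullet> nabla (ev f) (G \<theta> z)"
      by (metis dot_lmul_matrix vector_transpose_matrix transpose_transpose)
    also have "\<dots> = feature_deriv \<theta> z w \<bullet> f"
      using that G_in_\<Omega>[OF \<theta>]
      by (simp add: feature_deriv_def inner_vec_def inner_sum_left nabla_ev space_\<nu>
          inner_commute[of f] del: transpose_matrix_vector)
    finally show ?thesis .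
  qed
  \<comment> \<open>Integrability of the vector \<open>?F\<close> is obtained coordinatewise:
    pairing with \<open>b\<close> yields \<open>feature_deriv \<theta> z b \<bullet> f\<close>,
    which is integrable.\<close>
  have "integrable \<nu> (\<lambda>z. ?F z \<bullet> b)" for b
    using feature_deriv_integrable[OF \<theta>, of b]
    by (subst Bochner_Integration.integrable_cong[where g = "\<lambda>z. feature_deriv \<theta> z b \<bullet> f"])
      (auto simp: inner_F inner_commute[of _ b])
  then have "integrable \<nu> (\<lambda>z. \<Sum>b\<in>Basis. (?F z \<bullet> b) *\<^sub>R b)"
    by (intro Bochner_Integration.integrable_sum integrable_scaleR_left)
  then have "integrable \<nu> ?F"
    by (simp add: euclidean_representation)
  then have "v \<bullet> L_op ev \<nu> G \<theta> f = (\<integral>z. v \<bullet> ?F z \<partial>\<nu>)"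
    by (simp add: L_op_def)
  also have "\<dots> = (\<integral>z. feature_deriv \<theta> z v \<bullet> f \<partial>\<nu>)"
    by (intro Bochner_Integration.integral_cong) (auto simp: inner_F)
  also have "\<dots> = L_adj K \<nu> G \<theta> v \<bullet> f"
    by (simp add: L_adj_eq feature_deriv_integrable[OF \<theta>])
  finally show ?thesis .
qed

text \<open>Read off from adjointness: for fixed \<open>v\<close>, the inner product of
  \<open>v\<close> with the image of \<open>f\<close> is an inner product of \<open>f\<close> with a
  fixed element.\<close>

lemma linear_L_op:
  assumes "\<theta> \<in> \<Theta>"
  shows "linear (L_op ev \<nu> G \<theta>)"
proof (rule linearI)
  show "L_op ev \<nu> G \<theta> (f + g) = L_op ev \<nu> G \<theta> f + L_op ev \<nu> G \<theta> g" for f g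
    by (subst vector_eq_ldot[symmetric])
      (simp add: L_op_adjoint[OF assms] inner_add_right)
  show "L_op ev \<nu> G \<theta> (c *\<^sub>R f) = c *\<^sub>R L_op ev \<nu> G \<theta> f" for c f
    by (subst vector_eq_ldot[symmetric])
      (simp add: L_op_adjoint[OF assms])
qed

text \<open>Contains both the symmetry and the positive semidefiniteness of
  \<open>D_op\<close>.\<close>

lemma inner_D_op:
  assumes "\<theta> \<in> \<Theta>"
  shows "f \<bullet> D_op ev K \<nu> G \<theta> g = L_op ev \<nu> G \<theta> f \<bullet> L_op ev \<nu> G \<theta> g"
  using L_op_adjoint[OF assms, of "L_op ev \<nu> G \<theta> g" f] by (simp add: D_op_def inner_commute)

text \<open>\<open>D_op\<close> sees a preimage only through its image under \<open>L_op\<close>,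
  and \<open>inner_D_op\<close> does the same for the second term. The value is thus independent of
  the preimages, and the description in \<open>metric_tensor\<close> is proper.\<close>

lemma metric_tensor_eq:
  assumes "\<theta> \<in> \<Theta>" "\<xi> \<in> range (L_op ev \<nu> G \<theta>)" "\<zeta> \<in> range (L_op ev \<nu> G \<theta>)"
  shows "metric_tensor \<alpha> \<beta> ev K \<nu> G \<theta> \<xi> \<zeta>
    = \<alpha> * (L_adj K \<nu> G \<theta> \<xi> \<bullet> L_adj K \<nu> G \<theta> \<zeta>) + \<beta> * (\<xi> \<bullet> \<zeta>)"
proof -
  have *: "\<alpha> * (D_op ev K \<nu> G \<theta> \<phi>\<^sub>1 \<bullet> D_op ev K \<nu> G \<theta> \<phi>\<^sub>2) + \<beta> * (\<phi>\<^sub>1 \<bullet> D_op ev K \<nu> G \<theta> \<phi>\<^sub>2)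
      = \<alpha> * (L_adj K \<nu> G \<theta> \<xi> \<bullet> L_adj K \<nu> G \<theta> \<zeta>) + \<beta> * (\<xi> \<bullet> \<zeta>)"
    if "\<xi> = L_op ev \<nu> G \<theta> \<phi>\<^sub>1" "\<zeta> = L_op ev \<nu> G \<theta> \<phi>\<^sub>2" for \<phi>\<^sub>1 \<phi>\<^sub>2
    using inner_D_op[OF assms(1), of \<phi>\<^sub>1 \<phi>\<^sub>2] that by (simp only: D_op_def)
  obtain \<phi> \<psi> where "\<xi> = L_op ev \<nu> G \<theta> \<phi>" "\<zeta> = L_op ev \<nu> G \<theta> \<psi>"
    using assms(2,3) by blast
  with * show ?thesis
    unfolding metric_tensor_def by (intro the_equality) metis+
qed

text \<open>
  Since \<open>D_op\<close> factors through \<open>\<real>\<^sup>n\<close>, the equation for \<open>u\<close> reduces to a positive definite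
  system for \<open>w = L u\<close>.
\<close>

lemma ex1_regularized_solution:
  assumes \<theta>: "\<theta> \<in> \<Theta>" and "\<alpha> > 0" "\<beta> > 0"
  shows "\<exists>!u. \<alpha> *\<^sub>R D_op ev K \<nu> G \<theta> u + \<beta> *\<^sub>R u = m"
proof (rule ex_ex1I)
  let ?L = "L_op ev \<nu> G \<theta>" and ?A = "L_adj K \<nu> G \<theta>"
  interpret L: linear ?L by (rule linear_L_op[OF \<theta>])
  interpret A: bounded_linear ?A by (rule bounded_linear_L_adj[OF \<theta>])
  \<comment> \<open>Applying \<open>?L\<close> to the equation for \<open>u\<close> and writing
    \<open>w\<close> for \<open>?L u\<close> gives \<open>S w = ?L m\<close>.\<close>
  define S where "S w = \<beta> *\<^sub>R w + \<alpha> *\<^sub>R ?L (?A w)" for w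
  have lin: "linear S"
    by (rule linearI) (simp_all add: S_def A.add A.scaleR L.add L.scale algebra_simps)
  have "w = 0" if "S w = 0" for w
  proof -
    have "\<alpha> * (?A w \<bullet> ?A w) + \<beta> * (w \<bullet> w) = w \<bullet> S w"
      by (simp add: S_def inner_add_right L_op_adjoint[OF \<theta>])
    also have "\<dots> = 0"
      using that by simp
    finally show ?thesis
      by (rule weighted_inner_self_sum_eq_0[OF assms(2,3)])
  qed
  then have "inj S"
    using lin by (simp add: linear_injective_0)
  \<comment> \<open>An injective linear endomorphism of a finite-dimensional space is
    surjective.\<close>
  then have "surj S"
    using lin linear_injective_imp_surjective by blast
  then obtain w where w: "S w = ?L m"
    by (metis surj_def)
  \<comment> \<open>This solves the original equation for \<open>u\<close> with \<open>?L u\<close>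
    replaced by \<open>w\<close>; it remains to see that \<open>?L u\<close> really is
    \<open>w\<close>.\<close>
  define u where "u = inverse \<beta> *\<^sub>R (m - \<alpha> *\<^sub>R ?A w)"
  have "\<beta> *\<^sub>R ?L u = ?L m - \<alpha> *\<^sub>R ?L (?A w)"
    using assms(3) by (simp add: u_def L.scale L.diff)
  also have "\<dots> = \<beta> *\<^sub>R w"
    unfolding w[symmetric] S_def by simp
  finally have "?L u = w"
    using assms(3) by simp
  then have "\<alpha> *\<^sub>R D_op ev K \<nu> G \<theta> u + \<beta> *\<^sub>R u = m"
    using assms(3) by (simp add: D_op_def u_def)
  then show "\<exists>u. \<alpha> *\<^sub>R D_op ev K \<nu> G \<theta> u + \<beta> *\<^sub>R u = m" ..
  fix u u'
  assume u: "\<alpha> *\<^sub>R D_op ev K \<nu> G \<theta> u + \<beta> *\<^sub>R u = m"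
    and u': "\<alpha> *\<^sub>R D_op ev K \<nu> G \<theta> u' + \<beta> *\<^sub>R u' = m"
  define d where "d = u - u'"
  have "\<alpha> *\<^sub>R D_op ev K \<nu> G \<theta> d + \<beta> *\<^sub>R d = 0"
    using u u' by (simp add: d_def D_op_def A.diff L.diff algebra_simps)
  then have "d \<bullet> (\<alpha> *\<^sub>R D_op ev K \<nu> G \<theta> d + \<beta> *\<^sub>R d) = 0"
    by simp
  then have "\<alpha> * (?L d \<bullet> ?L d) + \<beta> * (d \<bullet> d) = 0"
    by (simp add: inner_add_right inner_D_op[OF \<theta>])
  then have "d = 0"
    by (rule weighted_inner_self_sum_eq_0[OF assms(2,3)])
  then show "u = u'"
    by (simp add: d_def)
qed

section \<open>The gradient of the MMD energy and its flow\<close>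

context
  fixes \<alpha> \<beta> :: real and p :: "(real^'d) measure"
  assumes \<alpha>_pos: "\<alpha> > 0" and \<beta>_pos: "\<beta> > 0"
begin

abbreviation MMD_energy :: "(real^'d) measure \<Rightarrow> real" where
  "MMD_energy q \<equiv> 1/2 * (MMD \<Omega> ev K p q)\<^sup>2"

lemma MMD_energy_has_derivative:
  assumes \<theta>: "\<theta> \<in> \<Theta>"
  shows "((\<lambda>\<eta>. MMD_energy (pushforward_model \<Omega> \<nu> G \<eta>)) has_derivative
    (\<lambda>\<xi>. - (mean_embedding \<Omega> ev K p - mean_embedding \<Omega> ev K (pushforward_model \<Omega> \<nu> G \<theta>))
       \<bullet> L_adj K \<nu> G \<theta> \<xi>)) (at \<theta>)"
proof -
  let ?\<mu> = "mean_embedding \<Omega> ev K p" and ?M = "\<lambda>\<eta>. \<integral>z. K (G \<eta> z) \<partial>\<nu>"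
  have "((\<lambda>\<eta>. 1/2 * ((?\<mu> - ?M \<eta>) \<bullet> (?\<mu> - ?M \<eta>))) has_derivative
      (\<lambda>\<xi>. - (?\<mu> - ?M \<theta>) \<bullet> L_adj K \<nu> G \<theta> \<xi>)) (at \<theta>)"
    by (rule derivative_eq_intros refl has_derivative_mean_embedding_model[OF \<theta>])+
      (simp add: inner_commute inner_minus_left algebra_simps fun_eq_iff)
  \<comment> \<open>The integral form of the energy is available for parameters in
    \<open>\<Theta>\<close>; openness of \<open>\<Theta>\<close> transfers the derivative.\<close>
  then have "((\<lambda>\<eta>. MMD_energy (pushforward_model \<Omega> \<nu> G \<eta>)) has_derivative
      (\<lambda>\<xi>. - (?\<mu> - ?M \<theta>) \<bullet> L_adj K \<nu> G \<theta> \<xi>)) (at \<theta>)"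
    by (rule has_derivative_transform_within_open[OF _ open_\<Theta> \<theta>])
      (simp add: MMD_def mean_embedding_pushforward power2_norm_eq_inner)
  then show ?thesis
    by (simp add: mean_embedding_pushforward[OF \<theta>])
qed

text \<open>Existence: along every admissible curve the energy derivative is the metric tensor at
  \<open>L_op ev \<nu> G \<theta> u\<close> and the velocity. Uniqueness: two gradients are compared
  along a line in the direction of their difference.\<close>

lemma is_gradient_iff:
  assumes \<theta>: "\<theta> \<in> \<Theta>"
    and u: "\<alpha> *\<^sub>R D_op ev K \<nu> G \<theta> u + \<beta> *\<^sub>R u =
      - (mean_embedding \<Omega> ev K p - mean_embedding \<Omega> ev K (pushforward_model \<Omega> \<nu> G \<theta>))"
  shows "is_gradient \<alpha> \<beta> \<Omega> ev K \<nu> \<Theta> G MMD_energy \<theta> v \<longleftrightarrow> v = L_op ev \<nu> G \<theta> u"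
proof -
  let ?L = "L_op ev \<nu> G \<theta>" and ?A = "L_adj K \<nu> G \<theta>"
  interpret L: linear ?L by (rule linear_L_op[OF \<theta>])
  interpret A: bounded_linear ?A by (rule bounded_linear_L_adj[OF \<theta>])
  let ?E = "\<lambda>\<eta>. MMD_energy (pushforward_model \<Omega> \<nu> G \<eta>)"
  have energy: "((\<lambda>t. ?E (\<gamma> t)) has_real_derivative metric_tensor \<alpha> \<beta> ev K \<nu> G \<theta> (?L u) \<xi>) (at 0)"
    if \<gamma>: "\<gamma> 0 = \<theta>" "(\<gamma> has_vector_derivative \<xi>) (at 0)" and \<xi>: "\<xi> \<in> range ?L" for \<gamma> \<xi>
  proof -
    have "((\<lambda>t. ?E (\<gamma> t)) has_derivative
        (\<lambda>t. (\<alpha> *\<^sub>R D_op ev K \<nu> G \<theta> u + \<beta> *\<^sub>R u) \<bullet> ?A (t *\<^sub>R \<xi>))) (at 0)"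
      unfolding u
    proof (rule has_derivative_compose[where g = ?E])
      show "(\<gamma> has_derivative (\<lambda>t. t *\<^sub>R \<xi>)) (at 0)"
        using \<gamma>(2) by (simp add: has_vector_derivative_def)
    qed (use MMD_energy_has_derivative[OF \<theta>] \<gamma>(1) in simp)
    \<comment> \<open>The \<alpha> terms match by the definition of \<open>D_op\<close>; the \<beta>
      terms match because adjointness turns \<open>u \<bullet> ?A \<xi>\<close> into
      \<open>?L u \<bullet> \<xi>\<close>.\<close>
    moreover have "(\<alpha> *\<^sub>R D_op ev K \<nu> G \<theta> u + \<beta> *\<^sub>R u) \<bullet> ?A \<xi> = metric_tensor \<alpha> \<beta> ev K \<nu> G \<theta> (?L u) \<xi>"
      using L_op_adjoint[OF \<theta>, of \<xi> u]
      by (simp add: metric_tensor_eq[OF \<theta> _ \<xi>] inner_add_left D_op_def inner_commute[of \<xi>]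
          inner_commute[of "L_adj K \<nu> G \<theta> \<xi>"])
    ultimately show ?thesis
      by (simp add: has_field_derivative_def A.scaleR mult_commute_abs)
  qed
  show ?thesis
  proof
    assume grad: "is_gradient \<alpha> \<beta> \<Omega> ev K \<nu> \<Theta> G MMD_energy \<theta> v"
    then have v: "v \<in> range ?L"
      by (simp add: is_gradient_def)
    \<comment> \<open>The difference lies in the range of \<open>?L\<close> by linearity, so it is
      an admissible velocity.\<close>
    define \<xi> where "\<xi> = v - ?L u"
    have \<xi>: "\<xi> \<in> range ?L"
      using v by (auto simp: \<xi>_def simp flip: L.diff)
    define \<gamma> where "\<gamma> t = \<theta> + t *\<^sub>R \<xi>" for t :: real
    have deriv: "(\<gamma> has_vector_derivative \<xi>) (at t)" for t
      using has_derivative_add[OF has_derivative_const has_derivative_scaleR_left[OF has_derivative_ident]]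
      by (simp add: \<gamma>_def[abs_def] has_vector_derivative_def)
    have cont: "continuous_on UNIV \<gamma>"
      unfolding \<gamma>_def by (intro continuous_intros)
    have \<gamma>0: "\<gamma> 0 = \<theta>"
      by (simp add: \<gamma>_def)
    obtain \<epsilon> where \<epsilon>: "\<epsilon> > 0" "ball 0 \<epsilon> \<subseteq> \<gamma> -` \<Theta>"
      using continuous_on_open_vimage[OF open_UNIV] cont open_\<Theta> \<theta> \<gamma>0 open_contains_ball
      by (metis inf_top.right_neutral vimage_eq)
    have "\<gamma> ` {-\<epsilon><..<\<epsilon>} \<subseteq> \<Theta>"
      using \<epsilon>(2) by (auto simp: subset_eq ball_def)
    moreover have "\<gamma> differentiable_on {-\<epsilon><..<\<epsilon>}"
      using deriv by (auto simp: differentiable_on_def intro!: differentiableI_vector intro: has_vector_derivative_at_within)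
    ultimately have "((\<lambda>t. ?E (\<gamma> t)) has_real_derivative metric_tensor \<alpha> \<beta> ev K \<nu> G \<theta> v \<xi>) (at 0)"
      using grad \<epsilon>(1) \<gamma>0 deriv \<xi> unfolding is_gradient_def by blast
    then have "metric_tensor \<alpha> \<beta> ev K \<nu> G \<theta> v \<xi> = metric_tensor \<alpha> \<beta> ev K \<nu> G \<theta> (?L u) \<xi>"
      using energy[OF \<gamma>0 deriv \<xi>] by (rule DERIV_unique)
    \<comment> \<open>Subtracting the two values leaves the quadratic form of the metric at
      \<open>\<xi>\<close>.\<close>
    then have "\<alpha> * (?A \<xi> \<bullet> ?A \<xi>) + \<beta> * (\<xi> \<bullet> \<xi>) = 0"
      by (simp add: metric_tensor_eq[OF \<theta> v \<xi>] metric_tensor_eq[OF \<theta> rangeI \<xi>])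
        (simp add: \<xi>_def A.diff inner_diff_left algebra_simps)
    then have "\<xi> = 0"
      by (rule weighted_inner_self_sum_eq_0[OF \<alpha>_pos \<beta>_pos])
    then show "v = ?L u"
      by (simp add: \<xi>_def)
  next
    assume "v = ?L u"
    then show "is_gradient \<alpha> \<beta> \<Omega> ev K \<nu> \<Theta> G MMD_energy \<theta> v"
      using energy unfolding is_gradient_def by blast
  qed
qed

lemma gradient_eq:
  assumes "\<theta> \<in> \<Theta>"
    and "\<alpha> *\<^sub>R D_op ev K \<nu> G \<theta> u + \<beta> *\<^sub>R u =
      - (mean_embedding \<Omega> ev K p - mean_embedding \<Omega> ev K (pushforward_model \<Omega> \<nu> G \<theta>))"
  shows "gradient \<alpha> \<beta> \<Omega> ev K \<nu> \<Theta> G MMD_energy \<theta> = L_op ev \<nu> G \<theta> u"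
  unfolding gradient_def is_gradient_iff[OF assms] by simp

text \<open>Reconciles the signs: if \<open>f\<close> solves the equation of the flow, then
  \<open>- f\<close> solves that of the gradient.\<close>

lemma minus_gradient_eq:
  assumes \<theta>: "\<theta> \<in> \<Theta>"
    and f: "\<alpha> *\<^sub>R D_op ev K \<nu> G \<theta> f + \<beta> *\<^sub>R f =
      mean_embedding \<Omega> ev K p - mean_embedding \<Omega> ev K (pushforward_model \<Omega> \<nu> G \<theta>)"
  shows "- gradient \<alpha> \<beta> \<Omega> ev K \<nu> \<Theta> G MMD_energy \<theta> = L_op ev \<nu> G \<theta> f"
proof -
  interpret L: linear "L_op ev \<nu> G \<theta>" by (rule linear_L_op[OF \<theta>])
  interpret A: bounded_linear "L_adj K \<nu> G \<theta>" by (rule bounded_linear_L_adj[OF \<theta>])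
  have "gradient \<alpha> \<beta> \<Omega> ev K \<nu> \<Theta> G MMD_energy \<theta> = L_op ev \<nu> G \<theta> (- f)"
    by (rule gradient_eq[OF \<theta>]) (simp add: D_op_def L.neg A.neg flip: f)
  then show ?thesis
    by (simp add: L.neg)
qed

text \<open>At each time a solution \<open>f t\<close> makes the two velocities equal, so the
  backward direction only has to produce such solutions.\<close>

lemma regularized_flow_iff_gradient_flow:
  "(\<exists>f. is_regularized_flow \<alpha> \<beta> \<Omega> ev K \<nu> \<Theta> G p T \<theta> f) \<longleftrightarrow>
    is_gradient_flow \<alpha> \<beta> \<Omega> ev K \<nu> \<Theta> G MMD_energy T \<theta>"
proof
  assume "\<exists>f. is_regularized_flow \<alpha> \<beta> \<Omega> ev K \<nu> \<Theta> G p T \<theta> f"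
  then show "is_gradient_flow \<alpha> \<beta> \<Omega> ev K \<nu> \<Theta> G MMD_energy T \<theta>"
    unfolding is_regularized_flow_def is_gradient_flow_def by (metis minus_gradient_eq)
next
  assume flow: "is_gradient_flow \<alpha> \<beta> \<Omega> ev K \<nu> \<Theta> G MMD_energy T \<theta>"
  \<comment> \<open>Solvability at each time allows \<open>f\<close> to be chosen pointwise in
    \<open>t\<close>; \<open>is_regularized_flow\<close> asks for no regularity of \<open>f\<close>
    in time.\<close>
  have "\<forall>t\<in>T. \<exists>u. \<alpha> *\<^sub>R D_op ev K \<nu> G (\<theta> t) u + \<beta> *\<^sub>R u =
      mean_embedding \<Omega> ev K p - mean_embedding \<Omega> ev K (pushforward_model \<Omega> \<nu> G (\<theta> t))"
    using flow ex1_regularized_solution[OF _ \<alpha>_pos \<beta>_pos] unfolding is_gradient_flow_def by blast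
  then obtain f where "\<forall>t\<in>T. \<alpha> *\<^sub>R D_op ev K \<nu> G (\<theta> t) (f t) + \<beta> *\<^sub>R f t =
      mean_embedding \<Omega> ev K p - mean_embedding \<Omega> ev K (pushforward_model \<Omega> \<nu> G (\<theta> t))"
    by metis
  then have "is_regularized_flow \<alpha> \<beta> \<Omega> ev K \<nu> \<Theta> G p T \<theta> f"
    using flow unfolding is_regularized_flow_def is_gradient_flow_def by (metis minus_gradient_eq)
  then show "\<exists>f. is_regularized_flow \<alpha> \<beta> \<Omega> ev K \<nu> \<Theta> G p T \<theta> f"
    by (rule exI[of _ f])
qed

end

end

theorem corollary14:
  fixes \<Omega> :: "(real^'d) set" and Z :: "(real^'m) set" and \<Theta> :: "(real^'n) set"
    and ev :: "'h::{real_inner, banach, second_countable_topology} \<Rightarrow> real^'d \<Rightarrow> real"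
    and K :: "real^'d \<Rightarrow> 'h"
    and \<nu> :: "(real^'m) measure"
    and G :: "real^'n \<Rightarrow> real^'m \<Rightarrow> real^'d"
    and D :: "real^'m \<Rightarrow> real"
    and p :: "(real^'d) measure"
    and L B \<alpha> \<beta> :: real
  assumes "open \<Omega>" and "open Z" and "open \<Theta>"
    and rkhs: "rkhs \<Omega> ev K"
    and kernel_bounded: "\<forall>x\<in>\<Omega>. \<forall>y\<in>\<Omega>. \<bar>ev (K x) y\<bar> \<le> B"
    and kernel_differentiable: "\<forall>x\<in>\<Omega>. K differentiable (at x)"
    and "L > 0"
    and kernel_lipschitz: "\<forall>x\<in>\<Omega>. \<forall>y\<in>\<Omega>. norm (K x - K y) \<le> L * norm (x - y)"
    and "prob_space \<nu>" and "sets \<nu> = sets (restrict_space borel Z)"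
    and G_measurable: "\<forall>\<theta>\<in>\<Theta>. G \<theta> \<in> measurable \<nu> (restrict_space borel \<Omega>)"
    and G_differentiable: "\<forall>\<theta>\<in>\<Theta>. \<forall>z\<in>Z. (\<lambda>\<eta>. G \<eta> z) differentiable (at \<theta>)"
    and D_nonneg: "\<forall>z\<in>Z. D z \<ge> 0"
    and D_square_integrable: "integrable \<nu> (\<lambda>z. (D z)\<^sup>2)"
    and G_lipschitz: "\<forall>\<theta>\<in>\<Theta>. \<forall>\<theta>'\<in>\<Theta>. \<forall>z\<in>Z. norm (G \<theta> z - G \<theta>' z) \<le> D z * norm (\<theta> - \<theta>')"
    and "\<alpha> > 0" and "\<beta> > 0"
    and "prob_space p" and "sets p = sets (restrict_space borel \<Omega>)"
  shows
    "(\<forall>\<theta>\<in>\<Theta>.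
        (\<exists>!v. is_gradient \<alpha> \<beta> \<Omega> ev K \<nu> \<Theta> G (\<lambda>q. 1/2 * (MMD \<Omega> ev K p q)\<^sup>2) \<theta> v) \<and>
        (\<exists>!u. \<alpha> *\<^sub>R D_op ev K \<nu> G \<theta> u + \<beta> *\<^sub>R u =
           - (mean_embedding \<Omega> ev K p - mean_embedding \<Omega> ev K (pushforward_model \<Omega> \<nu> G \<theta>))) \<and>
        (\<forall>u. \<alpha> *\<^sub>R D_op ev K \<nu> G \<theta> u + \<beta> *\<^sub>R u =
           - (mean_embedding \<Omega> ev K p - mean_embedding \<Omega> ev K (pushforward_model \<Omega> \<nu> G \<theta>)) \<longrightarrow>
           gradient \<alpha> \<beta> \<Omega> ev K \<nu> \<Theta> G (\<lambda>q. 1/2 * (MMD \<Omega> ev K p q)\<^sup>2) \<theta> = L_op ev \<nu> G \<theta> u)) \<and>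
     (\<forall>T \<theta>. is_interval T \<longrightarrow>
        ((\<exists>f. is_regularized_flow \<alpha> \<beta> \<Omega> ev K \<nu> \<Theta> G p T \<theta> f) \<longleftrightarrow>
         is_gradient_flow \<alpha> \<beta> \<Omega> ev K \<nu> \<Theta> G (\<lambda>q. 1/2 * (MMD \<Omega> ev K p q)\<^sup>2) T \<theta>))"
proof -
  interpret kernel_model \<Omega> Z \<Theta> ev K \<nu> G D L B
    by (rule kernel_model.intro; rule assms[rule_format]; assumption)
  note ex1_solution = ex1_regularized_solution[OF _ \<open>\<alpha> > 0\<close> \<open>\<beta> > 0\<close>]
  have ex1_gradient: "\<exists>!v. is_gradient \<alpha> \<beta> \<Omega> ev K \<nu> \<Theta> G (\<lambda>q. 1/2 * (MMD \<Omega> ev K p q)\<^sup>2) \<theta> v"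
    if \<theta>: "\<theta> \<in> \<Theta>" for \<theta>
  proof -
    \<comment> \<open>Once some solution \<open>u\<close> is fixed, the equivalence in
      \<open>is_gradient_iff\<close> yields existence and uniqueness of the gradient
      together.\<close>
    obtain u where "\<alpha> *\<^sub>R D_op ev K \<nu> G \<theta> u + \<beta> *\<^sub>R u =
        - (mean_embedding \<Omega> ev K p - mean_embedding \<Omega> ev K (pushforward_model \<Omega> \<nu> G \<theta>))"
      using ex1_solution[OF \<theta>] by (meson ex1_implies_ex)
    from is_gradient_iff[OF \<open>\<alpha> > 0\<close> \<open>\<beta> > 0\<close> \<theta> this] show ?thesis
      by metis
  qed
  show ?thesis
    using \<open>\<alpha> > 0\<close> \<open>\<beta> > 0\<close>
    by (intro conjI ballI allI impI ex1_gradient ex1_solution gradient_eq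
        regularized_flow_iff_gradient_flow)
qed

end
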